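(* Let $A>0$, and let $\chi=(\hbar,\vartheta,B_{\mathrm{in}})$, $\chi'=(\hbar,\vartheta',B'_{\mathrm{in}})$ be triples of real numbers (with the same $\hbar$) satisfying $\hbar\neq0$, $\hbar-B_{\mathrm{in}}\vartheta\neq0$ and $\hbar-B'_{\mathrm{in}}\vartheta'\neq0$. Let $K\subset\mathbb R$ be a subfield over which $t:=\tfrac1{2\pi}$ is transcendental, and suppose $$\frac{\vartheta}{A},\ \frac{B_{\mathrm{in}}A}{\hbar},\ \frac{\vartheta'}{A},\ \frac{B'_{\mathrm{in}}A}{\hbar}\ \in K.$$ Let $$\Gamma_{\chi,L}=\Bigl\langle 1,\ -\tfrac{\vartheta}{2\pi A},\ -\tfrac1{2\pi},\ -\tfrac{B_{\mathrm{in}}A}{2\pi\hbar},\ \tfrac{\vartheta B_{\mathrm{in}}-\hbar}{(2\pi)^2\hbar}\Bigr\rangle_{\mathbb Z}\subset\mathbb R,$$ and let $\Gamma_{\chi',L}$ be the analogous subgroup with $(\vartheta',B'_{\mathrm{in}})$ in place of $(\vartheta,B_{\mathrm{in}})$. Then $\Gamma_{\chi,L}$ and $\Gamma_{\chi',L}$ are contained in the graded $K$-vector space $V_K:=K\oplus K\,t\oplus K\,t^2$, and any real $\lambda>0$ with $\Gamma_{\chi',L}=\lambda\,\Gamma_{\chi,L}$ satisfies $\lambda=1$.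
   Context: $\langle\cdots\rangle_{\mathbb Z}$ denotes the additive subgroup of $\mathbb R$ generated by the listed elements, and $\lambda\Gamma=\{\lambda g: g\in\Gamma\}$. $V_K\subset\mathbb R$ is the $K$-span of $1,t,t^2$, a direct sum because $t$ is transcendental over $K$, graded by the power of $t$. Origin of the notation: $L=(a_x,a_y)$ is a pair of positive spatial periods, $A=a_xa_y$, and $\Gamma_{\chi,L}=\tau_*(K_0(A^4_{\Theta_{\chi,L}}))$ is the range of the canonical trace on $K_0$ of the smooth noncommutative $4$-torus with (skew) deformation matrix $\Theta_{12}=-\frac{\vartheta}{2\pi A}$, $\Theta_{13}=\Theta_{24}=-\frac1{2\pi}$, $\Theta_{34}=-\frac{B_{\mathrm{in}}A}{2\pi\hbar}$, $\Theta_{14}=\Theta_{23}=0$; by Elliott's theorem this range is the explicit subgroup displayed in the claim. *)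

theory Defs
  imports
    Complex_Main
    "HOL-Algebra.Algebraic_Closure_Type"
    "HOL-Computational_Algebra.Group_Closure"
begin

abbreviation real_ring :: "real ring"
  where "real_ring \<equiv> ring_of_type_algebra"

abbreviation tpi :: real
  where "tpi \<equiv> 1 / (2 * pi)"

(* Of chi = (hbar, theta, Bin) and L = (a_x, a_y), the group depends on L only
   through the area A = a_x * a_y. *)
definition Gamma :: "real \<Rightarrow> real \<Rightarrow> real \<Rightarrow> real \<Rightarrow> real set"
  where "Gamma hbar theta Bin A = group_closure
    {1,
     - (theta / (2 * pi * A)),
     - (1 / (2 * pi)),
     - (Bin * A / (2 * pi * hbar)),
     (theta * Bin - hbar) / ((2 * pi)\<^sup>2 * hbar)}"

(* Span K us unfolds to the sum of the lines K u for u in us, so this is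
   K + K t + K t^2; the sum is direct iff the generating list is independent. *)
definition VK :: "real set \<Rightarrow> real set"
  where "VK K = ring.Span real_ring K [1, tpi, tpi\<^sup>2]"

end

theory Submission
  imports Defs
begin

text \<open>Since \<open>1\<close> lies in both groups, \<open>\<lambda>\<close> lies in the second one and \<open>1 = \<lambda> * g\<close> for some \<open>g\<close> in the
  first one. Both \<open>\<lambda>\<close> and \<open>g\<close> are polynomials of degree at most two in the transcendental \<open>t\<close> with
  integral constant term, so a product equal to \<open>1\<close> forces them to be units of \<open>K[t]\<close>, that is,
  constants. Thus \<open>\<lambda>\<close> is a positive integer whose inverse is an integer.\<close>

lemma ring_of_type_algebra_simps [simp]:
  "carrier ring_of_type_algebra = UNIV"
  "x \<otimes>\<^bsub>ring_of_type_algebra\<^esub> y = x * y"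
  "x \<oplus>\<^bsub>ring_of_type_algebra\<^esub> y = x + y"
  "\<one>\<^bsub>ring_of_type_algebra\<^esub> = 1"
  "\<zero>\<^bsub>ring_of_type_algebra\<^esub> = 0"
  by (simp_all add: ring_of_type_algebra_def)

lemma nat_pow_ring_of_type_algebra [simp]:
  fixes x :: "'a::comm_ring_1"
  shows "x [^]\<^bsub>ring_of_type_algebra\<^esub> (n::nat) = x ^ n"
  by (induction n) (simp_all add: nat_pow_def mult.commute)

lemma a_inv_ring_of_type_algebra [simp]:
  fixes x :: "'a::comm_ring_1"
  shows "\<ominus>\<^bsub>ring_of_type_algebra\<^esub> x = - x"
proof -
  interpret R: ring "ring_of_type_algebra :: 'a ring" by (rule ring_from_type_algebra)
  show ?thesis
    using R.minus_equality[of "- x" x] by simp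
qed

lemma subfield_ring_of_type_algebraD:
  fixes K :: "'a::field set"
  assumes "subfield K ring_of_type_algebra"
  shows "0 \<in> K" "1 \<in> K"
    and "x \<in> K \<Longrightarrow> - x \<in> K"
    and "x \<in> K \<Longrightarrow> y \<in> K \<Longrightarrow> x + y \<in> K"
    and "x \<in> K \<Longrightarrow> y \<in> K \<Longrightarrow> x - y \<in> K"
    and "x \<in> K \<Longrightarrow> y \<in> K \<Longrightarrow> x * y \<in> K"
proof -
  have K: "subring K ring_of_type_algebra"
    using assms by (rule subfieldE(1))
  show "0 \<in> K" "1 \<in> K" "x \<in> K \<Longrightarrow> - x \<in> K"
    using subringE(2,3,5)[OF K] by simp_all
  show "x + y \<in> K" "x * y \<in> K" if "x \<in> K" "y \<in> K"
    using subringE(6,7)[OF K that] by simp_all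
  show "x - y \<in> K" if "x \<in> K" "y \<in> K"
    using subringE(7)[OF K that(1) subringE(5)[OF K that(2)]] by simp
qed

lemma of_int_mem_subfield:
  fixes K :: "'a::field set"
  assumes "subfield K ring_of_type_algebra"
  shows "of_int n \<in> K"
proof (induction n rule: int_induct[where k = 0])
  case base
  show ?case using subfield_ring_of_type_algebraD(1)[OF assms] by simp
next
  case (step1 i)
  then show ?case using subfield_ring_of_type_algebraD(2,4)[OF assms] by simp
next
  case (step2 i)
  then show ?case using subfield_ring_of_type_algebraD(2,5)[OF assms] by simp
qed

text \<open>Transcendence is stated only for normalized coefficient lists, those with nonzero head.
  A zero head adds nothing to \<open>eval\<close>, so leading zeros can be stripped one by one by
  induction on the list.\<close>

lemma transcendental_eval_eq_0:
  fixes K :: "'a::field set"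
  assumes "ring.transcendental ring_of_type_algebra K x"
    and "set p \<subseteq> K" "ring.eval ring_of_type_algebra p x = 0"
  shows "set p \<subseteq> {0}"
  using assms(2,3)
proof (induction p)
  case Nil
  then show ?case by simp
next
  case (Cons a p)
  interpret R: ring "ring_of_type_algebra :: 'a ring" by (rule ring_from_type_algebra)
  have "a = 0"
  proof (rule ccontr)
    assume "a \<noteq> 0"
    then have "a # p \<in> carrier (univ_poly ring_of_type_algebra K)"
      using Cons.prems(1) by (simp add: univ_poly_def polynomial_def)
    moreover have "R.eval (a # p) x = \<zero>\<^bsub>ring_of_type_algebra\<^esub>"
      using Cons.prems(2) by (simp only: ring_of_type_algebra_simps)
    ultimately have "a # p = []"
      using R.eval_transcendental assms(1) unfolding over_def by blast
    then show False by simp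
  qed
  with Cons show ?case by simp
qed

text \<open>Degree four is the degree of a product of two quadratics; relations of lower degree are
  instances with zero top coefficients.\<close>

lemma transcendental_quartic:
  fixes K :: "'a::field set"
  assumes "ring.transcendental ring_of_type_algebra K x"
    and "a0 \<in> K" "a1 \<in> K" "a2 \<in> K" "a3 \<in> K" "a4 \<in> K"
    and "a0 + a1 * x + a2 * x^2 + a3 * x^3 + a4 * x^4 = 0"
  shows "a0 = 0 \<and> a1 = 0 \<and> a2 = 0 \<and> a3 = 0 \<and> a4 = 0"
proof -
  interpret R: ring "ring_of_type_algebra :: 'a ring" by (rule ring_from_type_algebra)
  \<comment> \<open>Coefficient lists start with the highest degree.\<close>
  have "R.eval [a4, a3, a2, a1, a0] x = 0"
    using assms(7) by (simp add: algebra_simps eval_nat_numeral)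
  with transcendental_eval_eq_0[OF assms(1), of "[a4, a3, a2, a1, a0]"] assms(2-6)
  show ?thesis by simp
qed

lemma mem_Span_1_x_x2_iff:
  fixes K :: "'a::field set"
  shows "v \<in> ring.Span ring_of_type_algebra K [1, x, x^2] \<longleftrightarrow>
    (\<exists>a\<in>K. \<exists>b\<in>K. \<exists>c\<in>K. v = a + b * x + c * x^2)"
proof -
  interpret R: ring "ring_of_type_algebra :: 'a ring" by (rule ring_from_type_algebra)
  show ?thesis
    by (auto simp: R.line_extension_def set_add_def' r_coset_def add.assoc)
qed

text \<open>Independence of a list asks that each entry lie outside the span of the later ones. Each
  failure would be a nontrivial relation of degree at most two in \<open>x\<close>.\<close>

lemma transcendental_imp_independent_1_x_x2:
  fixes K :: "'a::field set"
  assumes K: "subfield K ring_of_type_algebra"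
    and t: "ring.transcendental ring_of_type_algebra K x"
  shows "ring.independent ring_of_type_algebra K [1, x, x^2]"
proof -
  interpret R: field "ring_of_type_algebra :: 'a ring" by (rule field_from_type_algebra)
  note mem = subfield_ring_of_type_algebraD[OF K]
  note quartic = transcendental_quartic[OF t, where ?a3.0 = 0 and ?a4.0 = 0]
  have "1 \<notin> R.Span K [x, x^2]"
  proof
    assume "1 \<in> R.Span K [x, x^2]"
    then obtain b c where bc: "b \<in> K" "c \<in> K" and eq: "1 = b * x + c * x^2"
      by (auto simp: R.line_extension_mem_iff)
    \<comment> \<open>The regrouping exposes the right-hand side of \<open>eq\<close> as a subterm,
      which then folds back to 1.\<close>
    have "- 1 + b * x + c * x^2 = - 1 + (b * x + c * x^2)"
      by (rule add.assoc)
    also have "\<dots> = 0"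
      unfolding eq[symmetric] by simp
    finally have "- 1 + b * x + c * x^2 = 0" .
    then show False using quartic[of "-1" b c] bc mem(1-3) by simp
  qed
  moreover have "x \<notin> R.Span K [x^2]"
  proof
    assume "x \<in> R.Span K [x^2]"
    then have "\<exists>c\<in>K. x = c * x^2"
      by (simp add: R.line_extension_mem_iff)
    then obtain c where c: "c \<in> K" and eq: "x = c * x^2"
      by blast
    have "- x + c * x^2 = 0"
      unfolding eq[symmetric] by simp
    then show False using quartic[of 0 "-1" c] c mem(1-3) by simp
  qed
  moreover have "x^2 \<notin> R.Span K []"
    using quartic[of 0 0 1] mem(1,2) by auto
  ultimately show ?thesis
    by (intro R.li_Cons R.li_Nil) (simp_all del: R.Span.simps)
qed

lemma transcendental_quadratic_mult_eq_1:
  fixes K :: "'a::field set"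
  assumes K: "subfield K ring_of_type_algebra"
    and t: "ring.transcendental ring_of_type_algebra K x"
    and abc: "a \<in> K" "b \<in> K" "c \<in> K" and def: "d \<in> K" "e \<in> K" "f \<in> K"
    and eq: "(a + b * x + c * x^2) * (d + e * x + f * x^2) = 1"
  shows "a * d = 1 \<and> b = 0 \<and> c = 0 \<and> e = 0 \<and> f = 0"
proof -
  note mem = subfield_ring_of_type_algebraD[OF K]
  \<comment> \<open>The product minus 1, collected by powers of \<open>x\<close>: transcendence
    makes every coefficient vanish.\<close>
  have "(a * d - 1) + (a * e + b * d) * x + (a * f + b * e + c * d) * x^2
      + (b * f + c * e) * x^3 + (c * f) * x^4 =
      (a + b * x + c * x^2) * (d + e * x + f * x^2) - 1"
    by (simp add: algebra_simps power2_eq_square power3_eq_cube power4_eq_xxxx)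
  also have "\<dots> = 0" unfolding eq by simp
  finally have "a * d - 1 = 0 \<and> a * e + b * d = 0 \<and> a * f + b * e + c * d = 0
      \<and> b * f + c * e = 0 \<and> c * f = 0"
    by (intro transcendental_quartic[OF t]) (intro mem abc def)+
  \<comment> \<open>Since \<open>a * d = 1\<close>, both \<open>a\<close> and \<open>d\<close> are
    nonzero. From \<open>c * f = 0\<close>, one top coefficient vanishes, and the equations of lower
    degree then eliminate the other nonconstant ones.\<close>
  then show ?thesis by auto
qed

lemma one_in_Gamma: "1 \<in> Gamma hbar theta Bin A"
  unfolding Gamma_def by (rule group_closure.base) simp

text \<open>The constant term is recorded as an integer, not merely as an element of
  \<open>K\<close>: 1 is the only generator of degree 0 in \<open>tpi\<close>. Without integrality,
  other units of \<open>K\<close> would remain possible as scaling factors.\<close>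

lemma Gamma_E:
  assumes K: "subfield K real_ring"
    and "hbar \<noteq> 0" "A \<noteq> 0" "theta / A \<in> K" "Bin * A / hbar \<in> K"
    and "g \<in> Gamma hbar theta Bin A"
  obtains n :: int and b c where "b \<in> K" "c \<in> K" "g = of_int n + b * tpi + c * tpi^2"
proof -
  note mem = subfield_ring_of_type_algebraD[OF K]
  have "\<exists>n::int. \<exists>b\<in>K. \<exists>c\<in>K. g = of_int n + b * tpi + c * tpi^2"
    using assms(6) unfolding Gamma_def
  proof (induction rule: group_closure.induct)
    case (base s)
    \<comment> \<open>Instances of \<open>*\<close> below list the witnesses in the order
      \<open>b\<close>, \<open>c\<close>, \<open>n\<close>.\<close>
    have *: "?case" if "b \<in> K" "c \<in> K" "s = of_int n + b * tpi + c * tpi^2" for n :: int and b c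
      using that by blast
    from base show ?case
    proof (elim insertE emptyE)
      \<comment> \<open>The base rule of \<open>group_closure\<close> admits 0 beside the
        generators.\<close>
      assume "s = 0"
      then show ?case using *[of 0 0 0] mem by simp
    next
      assume "s = 1"
      then show ?case using *[of 0 0 1] mem by simp
    next
      assume "s = - (theta / (2 * pi * A))"
      then show ?case using *[of "- (theta / A)" 0 0] mem assms by simp
    next
      assume "s = - (1 / (2 * pi))"
      then show ?case using *[of "-1" 0 0] mem by simp
    next
      assume "s = - (Bin * A / (2 * pi * hbar))"
      then show ?case using *[of "- (Bin * A / hbar)" 0 0] mem assms by simp
    next
      assume s: "s = (theta * Bin - hbar) / ((2 * pi)\<^sup>2 * hbar)"
      \<comment> \<open>This generator is the Pfaffian of the deformation matrix. In the product of
        the two given elements of \<open>K\<close> the area cancels, leaving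
        \<open>theta * Bin / hbar\<close>.\<close>
      have "theta / A * (Bin * A / hbar) - 1 \<in> K" by (intro mem assms)
      moreover have "s = (theta / A * (Bin * A / hbar) - 1) * tpi^2"
        using s assms(2,3) by (simp add: field_simps power2_eq_square)
      ultimately show ?case using *[of 0 "theta / A * (Bin * A / hbar) - 1" 0] mem by simp
    qed
  next
    case (diff s u)
    from diff.IH obtain n m :: int and b c d e where
      K: "b \<in> K" "c \<in> K" "d \<in> K" "e \<in> K"
      and "s = of_int n + b * tpi + c * tpi^2" "u = of_int m + d * tpi + e * tpi^2"
      by blast
    then have "s - u = of_int (n - m) + (b - d) * tpi + (c - e) * tpi^2"
      by (simp only: of_int_diff left_diff_distrib)
    moreover have "b - d \<in> K" "c - e \<in> K"
      by (intro mem K)+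
    ultimately show ?case by blast
  qed
  with that show thesis by blast
qed

lemma Gamma_subset_VK:
  assumes "subfield K real_ring" "hbar \<noteq> 0" "A \<noteq> 0" "theta / A \<in> K" "Bin * A / hbar \<in> K"
  shows "Gamma hbar theta Bin A \<subseteq> VK K"
proof
  fix g assume "g \<in> Gamma hbar theta Bin A"
  then obtain n :: int and b c where "b \<in> K" "c \<in> K" "g = of_int n + b * tpi + c * tpi^2"
    using Gamma_E[OF assms] by blast
  then show "g \<in> VK K"
    unfolding VK_def mem_Span_1_x_x2_iff using of_int_mem_subfield[OF assms(1)] by blast
qed

theorem lemma5p3:
  fixes A hbar theta Bin theta' Bin' :: real and K :: "real set"
  assumes "A > 0"
    and "hbar \<noteq> 0"
    and "hbar - Bin * theta \<noteq> 0"
    and "hbar - Bin' * theta' \<noteq> 0"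
    and "subfield K real_ring"
    and "ring.transcendental real_ring K tpi"
    and "theta / A \<in> K"
    and "Bin * A / hbar \<in> K"
    and "theta' / A \<in> K"
    and "Bin' * A / hbar \<in> K"
  shows "ring.independent real_ring K [1, tpi, tpi\<^sup>2]
    \<and> Gamma hbar theta Bin A \<subseteq> VK K
    \<and> Gamma hbar theta' Bin' A \<subseteq> VK K
    \<and> (\<forall>l::real. l > 0 \<longrightarrow> Gamma hbar theta' Bin' A = (\<lambda>g. l * g) ` Gamma hbar theta Bin A \<longrightarrow> l = 1)"
proof (intro conjI allI impI)
  have A: "A \<noteq> 0" using assms(1) by simp
  show "ring.independent real_ring K [1, tpi, tpi\<^sup>2]"
    using assms(5,6) by (rule transcendental_imp_independent_1_x_x2)
  show "Gamma hbar theta Bin A \<subseteq> VK K" "Gamma hbar theta' Bin' A \<subseteq> VK K"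
    using Gamma_subset_VK[OF assms(5,2) A] assms(7-10) by simp_all
  fix l :: real
  assume l: "l > 0" and eq: "Gamma hbar theta' Bin' A = (\<lambda>g. l * g) ` Gamma hbar theta Bin A"
  have "l * 1 \<in> Gamma hbar theta' Bin' A"
    unfolding eq using one_in_Gamma by (rule imageI)
  then obtain n :: int and b c where bc: "b \<in> K" "c \<in> K"
    and l_eq: "l = of_int n + b * tpi + c * tpi^2"
    by (rule Gamma_E[OF assms(5,2) A assms(9,10)]) simp
  obtain g where g: "g \<in> Gamma hbar theta Bin A" "1 = l * g"
    using one_in_Gamma[of hbar theta' Bin' A] unfolding eq by blast
  obtain m :: int and e f where ef: "e \<in> K" "f \<in> K"
    and g_eq: "g = of_int m + e * tpi + f * tpi^2"
    by (rule Gamma_E[OF assms(5,2) A assms(7,8) g(1)])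
  have "of_int n * of_int m = (1::real) \<and> b = 0 \<and> c = 0 \<and> e = 0 \<and> f = 0"
    by (rule transcendental_quadratic_mult_eq_1[OF assms(5,6)])
      (use bc ef g(2) l_eq g_eq of_int_mem_subfield[OF assms(5)] in simp_all)
  then have "n * m = 1" "l = of_int n"
    using l_eq by (simp_all flip: of_int_mult)
  \<comment> \<open>An integer factorization of 1 leaves \<open>n = 1\<close> or
    \<open>n = -1\<close>; positivity of \<open>l\<close> excludes the latter.\<close>
  with l show "l = 1"
    by (simp add: zmult_eq_1_iff)
qed

end
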